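(* Let $n \ge k \ge 3$ be integers. Then $(K_n,k)$ is niche-realizable if and only if $(n,k)=(4,4)$ or $n\ge 5$.
   Context: $K_n$ is the complete graph on $n$ vertices. A $k$-partite tournament is an orientation of a complete $k$-partite graph with $k$ nonempty partite sets. The niche graph $\mathcal{N}(D)$ of a digraph $D$ has vertex set $V(D)$, and two distinct vertices are adjacent iff they have a common out-neighbor in $D$ or a common in-neighbor in $D$. The pair $(G,k)$ is niche-realizable if $G$ is isomorphic to the niche graph of some $k$-partite tournament. *)

theory Defs
  imports "Graph_Theory.Graph_Theory" "HOL-Library.Disjoint_Sets"
begin

text \<open>
  As in the library, an undirected graph is a finite symmetric loopless digraph.
  In particular \<^const>\<open>complete_digraph\<close> \<open>n G\<close> says that \<open>G\<close> is a complete graph on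
  \<open>n\<close> vertices.
\<close>

text \<open>
  The blocks of \<^const>\<open>partition_on\<close> are nonempty and pairwise disjoint.
\<close>
definition complete_partite_graph :: "nat \<Rightarrow> 'a pair_pre_digraph \<Rightarrow> bool" where
  "complete_partite_graph k G \<longleftrightarrow> pair_graph G \<and>
     (\<exists>P. partition_on (pverts G) P \<and> card P = k \<and>
          parcs G = {(u, v). \<exists>A\<in>P. \<exists>B\<in>P. A \<noteq> B \<and> u \<in> A \<and> v \<in> B})"

text \<open>\<open>D\<close> contains exactly one of the two arcs that represent each edge of \<open>G\<close>.\<close>
definition orientation_of :: "'a pair_pre_digraph \<Rightarrow> 'a pair_pre_digraph \<Rightarrow> bool" where
  "orientation_of D G \<longleftrightarrow> pverts D = pverts G \<and>
     parcs D \<union> (parcs D)\<inverse> = parcs G \<and> parcs D \<inter> (parcs D)\<inverse> = {}"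

definition partite_tournament :: "nat \<Rightarrow> 'a pair_pre_digraph \<Rightarrow> bool" where
  "partite_tournament k D \<longleftrightarrow> (\<exists>G. complete_partite_graph k G \<and> orientation_of D G)"

definition niche_graph :: "'a pair_pre_digraph \<Rightarrow> 'a pair_pre_digraph" where
  "niche_graph D = \<lparr> pverts = pverts D,
     parcs = {(u, v). u \<in> pverts D \<and> v \<in> pverts D \<and> u \<noteq> v \<and>
       ((\<exists>w\<in>pverts D. (u, w) \<in> parcs D \<and> (v, w) \<in> parcs D) \<or>
        (\<exists>w\<in>pverts D. (w, u) \<in> parcs D \<and> (w, v) \<in> parcs D))} \<rparr>"

text \<open>
  Letting \<open>D\<close> range over digraphs with vertices in the vertex type of \<open>G\<close> loses nothing:
  the niche graph has the same vertex set as \<open>D\<close>, so an isomorphism from it to \<open>G\<close>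
  transports \<open>D\<close> onto the vertex set of \<open>G\<close>.
\<close>
definition niche_realizable :: "('a, 'b) pre_digraph \<Rightarrow> nat \<Rightarrow> bool" where
  "niche_realizable G k \<longleftrightarrow>
     (\<exists>D :: 'a pair_pre_digraph. partite_tournament k D \<and>
        digraph_iso (with_proj (niche_graph D)) G)"

end

theory Submission
  imports Defs
begin

text \<open>
  If \<open>W\<close> carries a multipartite tournament without sinks and a source \<open>s\<close> is added as a
  new part, then \<open>s\<close> is a common in-neighbour of any two old vertices, and \<open>s\<close> shares with
  each old vertex every out-neighbour of the latter; so the niche graph is complete. Sinkless
  tournaments with \<open>j\<close> parts on \<open>m\<close> vertices are blow-ups of a sinkless tournament on \<open>j\<close>
  vertices (\<open>j \<ge> 3\<close>) or of the directed 4-cycle (\<open>j = 2\<close>, \<open>m \<ge> 4\<close>).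

  Conversely, if \<open>k = 3\<close> and \<open>n \<le> 4\<close>, two of the parts are singletons \<open>{b}\<close>, \<open>{c}\<close>. A vertex
  \<open>x\<close> of the third part can share a neighbour with \<open>b\<close> only in \<open>c\<close>, and with \<open>c\<close> only in
  \<open>b\<close>. A vertex \<open>x\<close> witnessing the adjacency of \<open>b\<close> and \<open>c\<close> then forces both orientations
  of the edge \<open>bc\<close>.
\<close>

section \<open>Isomorphism with a complete graph\<close>

text \<open>Injectivity on vertices pulls an arc of \<open>G\<close> between two images back to an
  arc of \<open>H\<close> between the original vertices.\<close>

lemma digraph_iso_completeD:
  assumes "complete_digraph n G" and "digraph_iso H G"
  shows "card (verts H) = n"
    and "\<lbrakk>u \<in> verts H; v \<in> verts H; u \<noteq> v\<rbrakk> \<Longrightarrow> (u, v) \<in> arcs_ends H"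
proof -
  obtain f where f: "pre_digraph.digraph_isomorphism H f" and G: "G = app_iso f H"
    using assms(2) by (auto simp: digraph_iso_def)
  have wf: "wf_digraph H" and inj: "inj_on (iso_verts f) (verts H)"
    using f by (auto simp: pre_digraph.digraph_isomorphism_def)
  then show "card (verts H) = n"
    using assms(1) by (simp add: complete_digraph_def G card_image)
  show "(u, v) \<in> arcs_ends H" if u: "u \<in> verts H" and v: "v \<in> verts H" and "u \<noteq> v"
  proof -
    have "iso_verts f u \<noteq> iso_verts f v"
      using inj u v \<open>u \<noteq> v\<close> by (auto dest: inj_onD)
    then have "(iso_verts f u, iso_verts f v) \<in> arcs_ends G"
      using assms(1) u v by (auto simp: complete_digraph_def G)
    then obtain e where e: "e \<in> arcs H" "iso_verts f u = iso_verts f (tail H e)"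
        "iso_verts f v = iso_verts f (head H e)"
      using f by (auto simp: arcs_ends_conv G pre_digraph.digraph_isomorphism_def)
    then have "u = tail H e" "v = head H e"
      using inj u v wf by (auto dest: inj_onD simp: wf_digraph_def)
    with e(1) show ?thesis
      by (auto simp: arcs_ends_conv)
  qed
qed

text \<open>The vertices stay fixed and only arcs are renamed. Since \<open>G\<close> has no
  parallel arcs, \<open>arc_to_ends G\<close> is injective on its arcs, and its inverse sends each
  pair to the arc of \<open>G\<close> with these ends.\<close>

lemma digraph_iso_completeI:
  assumes "complete_digraph n G" and "pverts H = verts G"
    and "parcs H = {(u, v). u \<in> verts G \<and> v \<in> verts G \<and> u \<noteq> v}"
  shows "digraph_iso (with_proj H) G"
proof -
  interpret graph G
    using assms(1) by (simp add: complete_digraph_def)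
  define f where "f = \<lparr>iso_verts = id, iso_arcs = inv_into (arcs G) (arc_to_ends G),
    iso_head = head G, iso_tail = tail G\<rparr>"
  have arcs: "parcs H = arc_to_ends G ` arcs G"
    using assms(1,3) by (auto simp: complete_digraph_def arcs_ends_def)
  have inj: "inj_on (arc_to_ends G) (arcs G)"
    using no_multi_arcs by (auto simp: inj_on_def)
  have "wf_digraph (with_proj H)"
    using assms(2,3) by unfold_locales auto
  then have "pre_digraph.digraph_isomorphism (with_proj H) f"
    unfolding pre_digraph.digraph_isomorphism_def
    by (auto simp: f_def arcs inj inv_into_f_f inj_on_inv_into arc_to_ends_def[of G, symmetric])
       (auto simp: arc_to_ends_def)
  moreover have "G = app_iso f (with_proj H)"
    using inj by (intro pre_digraph.equality) (simp_all add: f_def arcs assms(2) image_comp)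
  ultimately show ?thesis
    by (auto simp: digraph_iso_def)
qed

section \<open>Realizations from a source and a sinkless tournament\<close>

text \<open>The parts are the fibres of \<open>c\<close>; counting only colours that occur keeps
  them nonempty. \<open>R\<close> may be arbitrary within a fibre, as it is consulted only between
  different colours.\<close>

lemma partite_tournament_colouring:
  fixes c :: "'a \<Rightarrow> 'c"
  assumes "finite V"
    and "\<And>u v. \<lbrakk>u \<in> V; v \<in> V; c u \<noteq> c v\<rbrakk> \<Longrightarrow> R u v \<longleftrightarrow> \<not> R v u"
  shows "partite_tournament (card (c ` V))
    \<lparr>pverts = V, parcs = {(u, v). u \<in> V \<and> v \<in> V \<and> c u \<noteq> c v \<and> R u v}\<rparr>"
proof -
  define fibre where "fibre i = {v \<in> V. c v = i}" for i
  define K where "K = \<lparr>pverts = V, parcs = {(u, v). u \<in> V \<and> v \<in> V \<and> c u \<noteq> c v}\<rparr>"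
  have "finite {(u, v). u \<in> V \<and> v \<in> V \<and> c u \<noteq> c v}"
    by (rule finite_subset[of _ "V \<times> V"]) (use assms(1) in auto)
  then have "pair_graph K"
    using assms(1) by unfold_locales (auto simp: K_def symmetric_def sym_def)
  moreover have "partition_on V (fibre ` c ` V)"
    by (rule partition_onI) (auto simp: fibre_def disjnt_iff)
  moreover have "inj_on fibre (c ` V)"
    by (auto simp: inj_on_def fibre_def)
  then have "card (fibre ` c ` V) = card (c ` V)"
    by (rule card_image)
  moreover have "parcs K = {(u, v). \<exists>A\<in>fibre ` c ` V. \<exists>B\<in>fibre ` c ` V. A \<noteq> B \<and> u \<in> A \<and> v \<in> B}"
    by (auto simp: K_def fibre_def)
  moreover have "pverts K = V"
    by (simp add: K_def)
  ultimately have "complete_partite_graph (card (c ` V)) K"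
    unfolding complete_partite_graph_def by blast
  moreover have "orientation_of
      \<lparr>pverts = V, parcs = {(u, v). u \<in> V \<and> v \<in> V \<and> c u \<noteq> c v \<and> R u v}\<rparr> K"
    unfolding orientation_of_def K_def pair_pre_digraph.simps
  proof (intro conjI set_eqI)
    fix e :: "'a \<times> 'a"
    obtain u v where e: "e = (u, v)" by fastforce
    let ?E = "{(u, v). u \<in> V \<and> v \<in> V \<and> c u \<noteq> c v \<and> R u v}"
    show "e \<in> ?E \<union> ?E\<inverse> \<longleftrightarrow> e \<in> {(u, v). u \<in> V \<and> v \<in> V \<and> c u \<noteq> c v}"
      using assms(2)[of u v] by (auto simp: e)
    show "e \<in> ?E \<inter> ?E\<inverse> \<longleftrightarrow> e \<in> {}"
      using assms(2)[of u v] by (auto simp: e)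
  qed simp
  ultimately show ?thesis
    by (auto simp: partite_tournament_def)
qed

lemma niche_realizable_add_source:
  fixes c :: "'a \<Rightarrow> nat"
  assumes "complete_digraph n G" and V: "verts G = insert s W" "s \<notin> W"
    and colours: "c ` W = {..<j}"
    and antisym: "\<And>u v. \<lbrakk>u \<in> W; v \<in> W; c u \<noteq> c v\<rbrakk> \<Longrightarrow> R u v \<longleftrightarrow> \<not> R v u"
    and sinkless: "\<And>u. u \<in> W \<Longrightarrow> \<exists>v\<in>W. c u \<noteq> c v \<and> R u v"
  shows "niche_realizable G (Suc j)"
proof -
  have finV: "finite (insert s W)"
    using assms(1) V(1)
    by (metis complete_digraph_def digraph.axioms(1) fin_digraph.finite_verts graph.axioms(1))
  \<comment> \<open>The colours on \<open>W\<close> are those below \<open>j\<close>, so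
    \<open>j\<close> is fresh and \<open>{s}\<close> becomes a part of its own.\<close>
  define c' where "c' = c(s := j)"
  \<comment> \<open>Every arc at \<open>s\<close> leaves \<open>s\<close>. That
    \<open>R' s s\<close> holds is harmless, because arcs need different colours.\<close>
  define R' where "R' u v \<longleftrightarrow> u = s \<or> v \<noteq> s \<and> R u v" for u v
  define D where "D = \<lparr>pverts = insert s W, parcs =
    {(u, v). u \<in> insert s W \<and> v \<in> insert s W \<and> c' u \<noteq> c' v \<and> R' u v}\<rparr>"
  have c': "c' s = j" "\<And>u. u \<in> W \<Longrightarrow> c' u = c u"
    using V(2) by (auto simp: c'_def)
  then have "c' ` W = {..<j}"
    using colours by (metis image_cong)
  then have card: "card (c' ` insert s W) = Suc j"
    by (simp add: c')
  have "R' u v \<longleftrightarrow> \<not> R' v u" if "u \<in> insert s W" "v \<in> insert s W" "c' u \<noteq> c' v" for u v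
    using that antisym[of u v] by (auto simp: R'_def c')
  then have tournament: "partite_tournament (Suc j) D"
    unfolding D_def card[symmetric] by (rule partite_tournament_colouring[OF finV])
  have "c u \<noteq> j" if "u \<in> W" for u
    using colours that by auto
  then have source: "(s, u) \<in> parcs D" if "u \<in> W" for u
    using that by (simp add: D_def R'_def c') (metis)
  have out: "\<exists>w\<in>W. (u, w) \<in> parcs D" if "u \<in> W" for u
    using sinkless[OF that] that V(2) by (auto simp: D_def R'_def c')
  have "digraph_iso (with_proj (niche_graph D)) G"
  proof (rule digraph_iso_completeI[OF assms(1)])
    show "pverts (niche_graph D) = verts G"
      by (simp add: niche_graph_def D_def V)
    have *: "(\<exists>w\<in>pverts D. (u, w) \<in> parcs D \<and> (v, w) \<in> parcs D) \<or>
        (\<exists>w\<in>pverts D. (w, u) \<in> parcs D \<and> (w, v) \<in> parcs D)"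
      if "u \<in> insert s W" "v \<in> insert s W" "u \<noteq> v" for u v
    proof (cases "u \<in> W \<and> v \<in> W")
      case True
      then show ?thesis
        using source by (auto simp: D_def)
    next
      case False
      with that have "u = s \<and> v \<in> W \<or> v = s \<and> u \<in> W"
        by auto
      moreover have "W \<subseteq> pverts D"
        by (auto simp: D_def)
      ultimately show ?thesis
        using source out by blast
    qed
    have "pverts D = insert s W"
      by (simp add: D_def)
    then show "parcs (niche_graph D) = {(u, v). u \<in> verts G \<and> v \<in> verts G \<and> u \<noteq> v}"
      unfolding niche_graph_def V(1) using * by auto
  qed
  with tournament show ?thesis
    by (auto simp: niche_realizable_def)
qed

lemma sinkless_colouring_nat:
  assumes "j \<le> m" and "3 \<le> j \<or> j = 2 \<and> 4 \<le> m"
  obtains c :: "nat \<Rightarrow> nat" and R where "c ` {..<m} = {..<j}"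
    and "\<forall>x y. c x \<noteq> c y \<longrightarrow> (R x y \<longleftrightarrow> \<not> R y x)"
    and "\<forall>x<m. \<exists>y<m. c x \<noteq> c y \<and> R x y"
proof (cases "3 \<le> j")
  case True
  \<comment> \<open>The numbers below \<open>j - 1\<close> form singleton classes; all remaining
    ones share the colour \<open>j - 1\<close>.\<close>
  define c where "c x = min x (j - 1)" for x
  \<comment> \<open>the transitive tournament on the colours, with the arc between its extremes reversed\<close>
  define R where "R x y \<longleftrightarrow>
    c x = 0 \<and> c y = j - 1 \<or> c y < c x \<and> \<not> (c y = 0 \<and> c x = j - 1)" for x y
  show ?thesis
  proof (rule that; (intro allI impI)?)
    have "i \<in> c ` {..<m}" if "i < j" for i
      using that assms(1) by (intro image_eqI[of _ _ i]) (auto simp: c_def)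
    then show "c ` {..<m} = {..<j}"
      using True by (auto simp: c_def)
    show "R x y \<longleftrightarrow> \<not> R y x" if "c x \<noteq> c y" for x y
      using that True by (auto simp: R_def)
    show "\<exists>y<m. c x \<noteq> c y \<and> R x y" if "x < m" for x
    proof -
      \<comment> \<open>Colour 0 beats \<open>j - 1\<close> by the reversed arc, the intermediate
        colours beat 0, and \<open>j - 1\<close> beats 1, which lies strictly between the extremes
        because \<open>3 \<le> j\<close>.\<close>
      define y where "y = (if x = 0 then j - 1 else if x < j - 1 then 0 else 1)"
      have "y < m" "c x \<noteq> c y \<and> R x y"
        using True assms(1) that by (auto simp: y_def c_def R_def)
      then show ?thesis by blast
    qed
  qed
next
  case False
  then have j: "j = 2" "4 \<le> m"
    using assms by auto
  \<comment> \<open>The directed 4-cycle on the residues modulo 4 alternates between even and odd,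
    so parity gives its two parts.\<close>
  define c :: "nat \<Rightarrow> nat" where "c x = x mod 2" for x
  define R :: "nat \<Rightarrow> nat \<Rightarrow> bool" where "R x y \<longleftrightarrow> y mod 4 = Suc x mod 4" for x y
  show ?thesis
  proof (rule that; (intro allI impI)?)
    have "i \<in> c ` {..<m}" if "i < 2" for i
      using that j by (intro image_eqI[of _ _ i]) (auto simp: c_def)
    then show "c ` {..<m} = {..<j}"
      using j by (auto simp: c_def)
    show "R x y \<longleftrightarrow> \<not> R y x" if "c x \<noteq> c y" for x y
    proof -
      \<comment> \<open>Parity and \<open>R\<close> depend only on residues modulo 4, which leaves
        finitely many cases.\<close>
      define a b where "a = x mod 4" and "b = y mod 4"
      have "a \<in> {0, 1, 2, 3}" "b \<in> {0, 1, 2, 3}"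
        by (auto simp: a_def b_def)
      moreover have "a mod 2 \<noteq> b mod 2"
        using that by (simp add: c_def a_def b_def mod_mod_cancel)
      ultimately have "b = Suc a mod 4 \<longleftrightarrow> a \<noteq> Suc b mod 4"
        by (elim insertE emptyE) simp_all
      moreover have "R x y \<longleftrightarrow> b = Suc a mod 4" "R y x \<longleftrightarrow> a = Suc b mod 4"
        by (simp_all add: R_def a_def b_def mod_Suc_eq)
      ultimately show ?thesis
        by simp
    qed
    show "\<exists>y<m. c x \<noteq> c y \<and> R x y" if "x < m" for x
    proof (intro exI conjI)
      \<comment> \<open>The successor residue itself serves as the out-neighbour;
        \<open>4 \<le> m\<close> ensures that it is in range.\<close>
      have "Suc x mod 4 < 4" by simp
      with j show "Suc x mod 4 < m" by linarith
      have "c (Suc x mod 4) = Suc x mod 2"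
        by (simp add: c_def mod_mod_cancel)
      then show "c x \<noteq> c (Suc x mod 4)"
        by (simp add: c_def mod_Suc)
      show "R x (Suc x mod 4)" by (simp add: R_def)
    qed
  qed
qed

text \<open>One vertex becomes the source, and a numbering of the other \<open>n - 1\<close> carries
  over a sinkless tournament with \<open>k - 1\<close> parts. The case \<open>k = 3\<close> needs
  the 4-cycle, hence \<open>n - 1 \<ge> 4\<close>.\<close>

lemma niche_realizable_complete:
  fixes G :: "('a, 'b) pre_digraph"
  assumes "complete_digraph n G" and "k \<le> n" and "4 \<le> k \<or> k = 3 \<and> 5 \<le> n"
  shows "niche_realizable G k"
proof -
  have "card (verts G) = n"
    using assms(1) by (simp add: complete_digraph_def)
  moreover have "n = Suc (n - 1)"
    using assms(2,3) by auto
  ultimately obtain s W where V: "verts G = insert s W" "s \<notin> W" and "card W = n - 1"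
    by (metis card_Suc_eq)
  moreover have "n - 1 > 0"
    using assms(2,3) by auto
  ultimately obtain f where f: "bij_betw f W {..<n - 1}"
    using ex_bij_betw_finite_nat[of W] card_gt_0_iff[of W]
    by (auto simp: atLeast0LessThan)
  have "k - 1 \<le> n - 1" "3 \<le> k - 1 \<or> k - 1 = 2 \<and> 4 \<le> n - 1"
    using assms(2,3) by auto
  then obtain c R where c: "c ` {..<n - 1} = {..<k - 1}"
    and antisym: "\<forall>x y. c x \<noteq> c y \<longrightarrow> (R x y \<longleftrightarrow> \<not> R y x)"
    and sinkless: "\<forall>x<n - 1. \<exists>y<n - 1. c x \<noteq> c y \<and> R x y"
    by (rule sinkless_colouring_nat)
  have im: "f ` W = {..<n - 1}"
    using f by (simp add: bij_betw_def)
  have "niche_realizable G (Suc (k - 1))"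
  proof (rule niche_realizable_add_source[OF assms(1) V])
    show "(c \<circ> f) ` W = {..<k - 1}"
      by (simp only: image_comp[symmetric] im c)
    show "R (f u) (f v) \<longleftrightarrow> \<not> R (f v) (f u)" if "(c \<circ> f) u \<noteq> (c \<circ> f) v" for u v
      using antisym[rule_format, of "f u" "f v"] that by simp
    show "\<exists>v\<in>W. (c \<circ> f) u \<noteq> (c \<circ> f) v \<and> R (f u) (f v)" if u: "u \<in> W" for u
    proof -
      have "f u < n - 1"
        using u im by auto
      then obtain y where "y \<in> f ` W" "c (f u) \<noteq> c y" "R (f u) y"
        using sinkless im by blast
      then show ?thesis by auto
    qed
  qed
  moreover have "Suc (k - 1) = k"
    using assms(3) by auto
  ultimately show ?thesis
    by simp
qed

section \<open>Three parts on at most four vertices\<close>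

text \<open>Three positive part sizes with sum at most 4 include at most one that exceeds 1.\<close>

lemma partition_three_two_singletons:
  assumes "partition_on V P" and "finite V" and "card P = 3" and "card V \<le> 4"
  obtains A b c where "P = {A, {b}, {c}}" and "A \<noteq> {b}" and "A \<noteq> {c}" and "b \<noteq> c"
proof -
  obtain X Y Z where P: "P = {X, Y, Z}" and neq: "X \<noteq> Y" "X \<noteq> Z" "Y \<noteq> Z"
    using assms(3) by (auto simp: card_Suc_eq numeral_3_eq_3)
  have finite: "finite B" if "B \<in> P" for B
    using that assms(2) partition_onD1[OF assms(1)] by (auto intro: finite_subset)
  then have "sum card P = card V"
    using product_partition[OF assms(1)] by simp
  then have sum: "card X + card Y + card Z \<le> 4"
    using assms(4) P neq by simp
  have "card B > 0" if "B \<in> P" for B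
    using that finite[OF that] partition_onD3[OF assms(1)] by (auto simp: card_gt_0_iff)
  then have "card X > 0" "card Y > 0" "card Z > 0"
    using P by auto
  with sum consider "card Y = 1" "card Z = 1" | "card X = 1" "card Z = 1" | "card X = 1" "card Y = 1"
    by linarith
  then show ?thesis
  proof cases
    case 1
    then obtain b c where "Y = {b}" "Z = {c}" by (meson card_1_singletonE)
    then show ?thesis using that[of X b c] P neq by auto
  next
    case 2
    then obtain b c where "X = {b}" "Z = {c}" by (meson card_1_singletonE)
    then show ?thesis using that[of Y b c] P neq by auto
  next
    case 3
    then obtain b c where "X = {b}" "Y = {c}" by (meson card_1_singletonE)
    then show ?thesis using that[of Z b c] P neq by auto
  qed
qed

lemma not_niche_realizable_complete:
  fixes G :: "('a, 'b) pre_digraph"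
  assumes "complete_digraph n G" and "n \<le> 4"
  shows "\<not> niche_realizable G 3"
proof
  assume "niche_realizable G 3"
  then obtain D K :: "'a pair_pre_digraph" where K: "complete_partite_graph 3 K" "orientation_of D K"
    and iso: "digraph_iso (with_proj (niche_graph D)) G"
    by (auto simp: niche_realizable_def partite_tournament_def)
  note niche = digraph_iso_completeD[OF assms(1) iso, simplified]
  have verts: "pverts K = pverts D"
    using K(2) by (simp add: orientation_of_def)
  obtain P where P: "partition_on (pverts D) P" "card P = 3"
    and parcs: "parcs K = {(u, v). \<exists>A\<in>P. \<exists>B\<in>P. A \<noteq> B \<and> u \<in> A \<and> v \<in> B}"
    using K(1) verts by (auto simp: complete_partite_graph_def)
  have "finite (pverts D)"
    using K(1) verts pair_fin_digraph.pair_finite_verts pair_digraph.axioms(1) pair_graph.axioms(1)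
    by (metis complete_partite_graph_def)
  moreover have "card (pverts D) \<le> 4"
    using niche(1) assms(2) by (simp add: niche_graph_def)
  ultimately obtain A b c where Pabc: "P = {A, {b}, {c}}"
    and neq: "A \<noteq> {b}" "A \<noteq> {c}" "b \<noteq> c"
    by (rule partition_three_two_singletons[OF P(1) _ P(2)])
  have V: "pverts D = A \<union> {b, c}"
    using P(1) Pabc by (auto dest: partition_onD1)
  have "disjoint P"
    using P(1) by (rule partition_onD2)
  then have A: "b \<notin> A" "c \<notin> A"
    using Pabc neq by (auto simp: disjoint_def)
  have within: "(x, y) \<notin> parcs D" if "x \<in> A" "y \<in> A" for x y
  proof
    assume "(x, y) \<in> parcs D"
    then have "(x, y) \<in> parcs K"
      using K(2) by (auto simp: orientation_of_def)
    then obtain B C where "B \<in> P" "C \<in> P" "B \<noteq> C" "x \<in> B" "y \<in> C"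
      using parcs by blast
    with A that Pabc show False
      by auto
  qed
  have asym: "(y, x) \<notin> parcs D" if "(x, y) \<in> parcs D" for x y
    using K(2) that by (auto simp: orientation_of_def)
  have adj: "(\<exists>w\<in>pverts D. (u, w) \<in> parcs D \<and> (v, w) \<in> parcs D) \<or>
      (\<exists>w\<in>pverts D. (w, u) \<in> parcs D \<and> (w, v) \<in> parcs D)"
    if "u \<in> pverts D" "v \<in> pverts D" "u \<noteq> v" for u v
    using niche(2)[of u v] that by (auto simp: niche_graph_def)
  have loop: "(x, x) \<notin> parcs D" for x
    using asym by blast
  \<comment> \<open>A common neighbour of \<open>x\<close> and \<open>b\<close> is not in
    \<open>A\<close>, which spans no arcs, and is not \<open>b\<close>, as there are no loops; only
    \<open>c\<close> remains.\<close>
  have xb: "(x, c) \<in> parcs D \<and> (b, c) \<in> parcs D \<or> (c, x) \<in> parcs D \<and> (c, b) \<in> parcs D"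
    if "x \<in> A" for x
    using adj[of x b] that A within loop V by auto
  have xc: "(x, b) \<in> parcs D \<and> (c, b) \<in> parcs D \<or> (b, x) \<in> parcs D \<and> (b, c) \<in> parcs D"
    if "x \<in> A" for x
    using adj[of x c] that A within loop V by auto
  obtain x where "x \<in> A" "(b, x) \<in> parcs D \<and> (c, x) \<in> parcs D \<or> (x, b) \<in> parcs D \<and> (x, c) \<in> parcs D"
    using adj[of b c] neq V loop by auto
  \<comment> \<open>If both arcs enter \<open>x\<close>, then \<open>xb\<close> gives the arc from
    \<open>c\<close> to \<open>b\<close> and \<open>xc\<close> the arc from \<open>b\<close> to
    \<open>c\<close>; if both leave \<open>x\<close>, the two roles are exchanged.\<close>
  with xb[of x] xc[of x] asym show False
    by blast
qed

theorem theorem4p1: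
  fixes n k :: nat and G :: "('a, 'b) pre_digraph"
  assumes "n \<ge> k" and "k \<ge> 3"
    and "complete_digraph n G"
  shows "niche_realizable G k \<longleftrightarrow> (n, k) = (4, 4) \<or> n \<ge> 5"
proof
  assume "niche_realizable G k"
  then have "\<not> (n \<le> 4 \<and> k = 3)"
    using not_niche_realizable_complete assms(3) by blast
  with assms(1,2) show "(n, k) = (4, 4) \<or> n \<ge> 5"
    by auto
next
  assume "(n, k) = (4, 4) \<or> n \<ge> 5"
  with assms(1,2) have "4 \<le> k \<or> k = 3 \<and> 5 \<le> n"
    by auto
  with assms(1,3) show "niche_realizable G k"
    by (intro niche_realizable_complete)
qed

end
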